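(* Let $n \geq 1$ be an integer and $p \in [0,1]$. The expectation of the Euler characteristic $\chi$ on the Erdős–Rényi probability space $G(n,p)$ is $$ \mathrm{E}_{n,p}[\chi] = \sum_{k=1}^n (-1)^{k+1} \binom{n}{k} p^{\binom{k}{2}} . $$
   Context: All graphs are finite, simple and undirected. The Euler characteristic of a finite graph $G$ is $\chi(G) = \sum_{k=0}^{\infty} (-1)^k v_k$, where $v_k$ is the number of complete subgraphs $K_{k+1}$ (cliques with $k+1$ vertices) in $G$. The probability space $G(n,p)$ is the set of all graphs on the fixed vertex set $\{1,\dots,n\}$, where each of the $n(n-1)/2$ possible edges is present independently with probability $p$. $\mathrm{E}_{n,p}$ denotes expectation on $G(n,p)$. The convention $0^0=1$ is used. *)

theory Defs
  imports "HOL-Probability.Probability"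
begin

text \<open>
  A simple undirected graph is a pair of a vertex set and an edge set, each edge being
  a two-element set of vertices.
\<close>

type_synonym 'a graph = "'a set \<times> 'a set set"

definition all_edges :: "'a set \<Rightarrow> 'a set set" where
  "all_edges V = {e. e \<subseteq> V \<and> card e = 2}"

definition simple_graphs :: "'a set \<Rightarrow> 'a graph set" where
  "simple_graphs V = {G. fst G = V \<and> snd G \<subseteq> all_edges V}"

definition cliques :: "'a graph \<Rightarrow> nat \<Rightarrow> 'a set set" where
  "cliques G m = {W. W \<subseteq> fst G \<and> finite W \<and> card W = m \<and> all_edges W \<subseteq> snd G}"

text \<open>
  The number of complete subgraphs on \<open>k + 1\<close> vertices is usually denoted \<open>v\<^sub>k\<close>;
  for a finite graph only finitely many terms of the series are nonzero
  (see \<open>euler_char_finite\<close> below).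
\<close>

definition euler_char :: "'a graph \<Rightarrow> real" where
  "euler_char G = (\<Sum>k. (-1) ^ k * real (card (cliques G (k + 1))))"

text \<open>
  One independent Bernoulli variable per potential edge; the edges of the random graph
  are those whose variable is true.
\<close>

definition gnp :: "nat \<Rightarrow> real \<Rightarrow> nat graph pmf" where
  "gnp n p = map_pmf (\<lambda>f. ({1..n}, {e \<in> all_edges {1..n}. f e}))
     (Pi_pmf (all_edges {1..n}) False (\<lambda>_. bernoulli_pmf p))"

lemma finite_all_edges [simp]: "finite V \<Longrightarrow> finite (all_edges V)"
  by (rule finite_subset[of _ "Pow V"]) (auto simp: all_edges_def)

lemma card_all_edges: "finite V \<Longrightarrow> card (all_edges V) = card V choose 2"
  by (simp add: all_edges_def n_subsets)

lemma set_pmf_gnp: "set_pmf (gnp n p) \<subseteq> simple_graphs {1..n}"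
  by (auto simp: gnp_def simple_graphs_def)

lemma pmf_gnp:
  assumes "p \<in> {0..1}" "G \<in> simple_graphs {1..n}"
  shows "pmf (gnp n p) G = p ^ card (snd G) * (1 - p) ^ ((n choose 2) - card (snd G))"
proof -
  define A where "A = all_edges {1..n}"
  define F where "F = (\<lambda>f. ({1..n}, {e \<in> A. f e}))"
  define M where "M = Pi_pmf A False (\<lambda>_. bernoulli_pmf p)"
  define g where "g = (\<lambda>e. e \<in> snd G)"
  have finA: "finite A" by (simp add: A_def)
  have sub: "snd G \<subseteq> A" and V: "fst G = {1..n}"
    using assms(2) by (auto simp: simple_graphs_def A_def)
  have supp: "f e = False" if "f \<in> set_pmf M" "e \<notin> A" for f e
    using that set_Pi_pmf_subset[OF finA, of False "\<lambda>_. bernoulli_pmf p"]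
    by (auto simp: M_def)
  have "pmf (gnp n p) G = measure_pmf.prob M (F -` {G})"
    by (simp add: gnp_def F_def M_def A_def pmf_map)
  also have "\<dots> = measure_pmf.prob M {g}"
  proof (rule measure_prob_cong_0)
    fix f assume f: "f \<in> F -` {G} - {g}"
    have "f \<notin> set_pmf M"
    proof
      assume "f \<in> set_pmf M"
      hence "f = g" using f supp by (fastforce simp: F_def g_def)
      thus False using f by simp
    qed
    thus "pmf M f = 0" by (simp add: set_pmf_iff)
  next
    fix f assume f: "f \<in> {g} - F -` {G}"
    have "F g = G" using sub V by (auto simp: F_def g_def prod_eq_iff)
    thus "pmf M f = 0" using f by auto
  qed
  also have "\<dots> = pmf M g" by (simp add: measure_pmf_single)
  also have "\<dots> = (\<Prod>e\<in>A. pmf (bernoulli_pmf p) (g e))"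
    unfolding M_def using sub by (intro pmf_Pi' finA) (auto simp: g_def)
  also have "\<dots> = (\<Prod>e\<in>A. if e \<in> snd G then p else 1 - p)"
    using assms(1) by (intro prod.cong) (auto simp: g_def)
  also have "\<dots> = p ^ card (snd G) * (1 - p) ^ card (A - snd G)"
    using sub by (simp add: prod.If_cases[OF finA] Int_absorb1 Diff_eq)
  also have "card (A - snd G) = (n choose 2) - card (snd G)"
    using card_Diff_subset[OF finite_subset[OF sub finA] sub] card_all_edges[of "{1..n}"]
    by (simp add: A_def)
  finally show ?thesis .
qed

lemma euler_char_finite:
  assumes "finite (fst G)"
  shows "euler_char G = (\<Sum>k<card (fst G). (-1) ^ k * real (card (cliques G (k + 1))))"
  unfolding euler_char_def
proof (rule suminf_finite)
  fix k assume k: "k \<notin> {..<card (fst G)}"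
  have "cliques G (k + 1) = {}"
  proof (rule ccontr)
    assume "cliques G (k + 1) \<noteq> {}"
    then obtain W where "W \<subseteq> fst G" "card W = k + 1"
      unfolding cliques_def by blast
    with card_mono[OF assms, of W] k show False by simp
  qed
  thus "(-1) ^ k * real (card (cliques G (k + 1))) = 0" by simp
qed simp

end

theory Submission
  imports Defs
begin

text \<open>
  The Euler characteristic is a signed sum of indicators, one for each nonempty vertex set
  \<open>W\<close>, of the event that \<open>W\<close> spans a clique. Its expectation is therefore the same signed
  sum of the probabilities of these events, however they depend on each other. If \<open>W\<close> has \<open>k\<close>
  elements, the event asks that \<open>k choose 2\<close> distinct edges be present, so by independence its
  probability is \<open>p ^ (k choose 2)\<close> (lemma \<open>prob_gnp_edges_present\<close>). There are \<open>n choose k\<close>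
  such \<open>W\<close>, which gives the expected number of cliques of each size
  (lemma \<open>expectation_card_cliques\<close>) and hence the formula.
\<close>

lemma fst_gnp: "G \<in> set_pmf (gnp n p) \<Longrightarrow> fst G = {1..n}"
  using set_pmf_gnp[of n p] by (auto simp: simple_graphs_def)

text \<open>
  Every random variable on \<open>gnp n p\<close> is integrable because there are only finitely many graphs
  on the vertex set.
\<close>

lemma integrable_gnp [simp]:
  fixes f :: "nat graph \<Rightarrow> real"
  shows "integrable (measure_pmf (gnp n p)) f"
proof (rule integrable_measure_pmf_finite, rule finite_subset[OF set_pmf_gnp])
  have "simple_graphs {1..n} = {{1..n}} \<times> Pow (all_edges {1..n})"
    by (auto simp: simple_graphs_def)
  then show "finite (simple_graphs {1..n})" by simp
qed

text \<open>
  The edge variables are independent, so requiring those in \<open>S\<close> to be true and leaving the others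
  free describes a box under the product distribution, whose probability factorises.
\<close>

lemma prob_gnp_edges_present:
  assumes "p \<in> {0..1}" and S: "S \<subseteq> all_edges {1..n}"
  shows "measure_pmf.prob (gnp n p) {G. S \<subseteq> snd G} = p ^ card S"
proof -
  let ?A = "all_edges {1..n}"
  let ?B = "\<lambda>e. if e \<in> S then {True} else UNIV"
  have "measure_pmf.prob (gnp n p) {G. S \<subseteq> snd G} =
      measure_pmf.prob (Pi_pmf ?A False (\<lambda>_. bernoulli_pmf p)) (Pi ?A ?B)"
    unfolding gnp_def measure_map_pmf
    by (rule arg_cong[where f = "measure_pmf.prob _"])
       (use S in \<open>auto simp: Pi_def split: if_splits\<close>)
  also have "\<dots> = (\<Prod>e\<in>?A. measure_pmf.prob (bernoulli_pmf p) (?B e))"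
    by (rule measure_Pi_pmf_Pi) simp
  also have "\<dots> = (\<Prod>e\<in>?A. if e \<in> S then p else 1)"
    using assms(1) by (intro prod.cong) (auto simp: measure_pmf_single)
  also have "\<dots> = p ^ card S"
    using S by (simp add: prod.If_cases Int_absorb1)
  finally show ?thesis .
qed

lemma card_cliques_eq_sum_indicator:
  assumes "finite (fst G)"
  shows "real (card (cliques G m)) =
    (\<Sum>W | W \<subseteq> fst G \<and> card W = m. indicator {H. all_edges W \<subseteq> snd H} G)"
proof -
  let ?X = "{W. W \<subseteq> fst G \<and> card W = m}"
  have fin: "finite ?X"
    using assms by (auto intro: finite_subset[of _ "Pow (fst G)"])
  have "cliques G m = ?X \<inter> {W. all_edges W \<subseteq> snd G}"
    using assms by (auto simp: cliques_def intro: finite_subset)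
  then show ?thesis
    using fin by (simp add: indicator_def sum.If_cases)
qed

text \<open>
  Linearity of expectation over the \<open>n choose m\<close> candidate vertex sets, which by symmetry all
  contribute the same probability.
\<close>

lemma expectation_card_cliques:
  assumes "p \<in> {0..1}"
  shows "measure_pmf.expectation (gnp n p) (\<lambda>G. real (card (cliques G m))) =
    real (n choose m) * p ^ (m choose 2)"
proof -
  let ?X = "{W. W \<subseteq> {1..n} \<and> card W = m}"
  have "measure_pmf.expectation (gnp n p) (\<lambda>G. real (card (cliques G m))) =
      measure_pmf.expectation (gnp n p)
        (\<lambda>G. \<Sum>W\<in>?X. indicator {H. all_edges W \<subseteq> snd H} G)"
    by (intro integral_cong_AE) (auto simp: AE_measure_pmf_iff card_cliques_eq_sum_indicator
        dest!: fst_gnp)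
  also have "\<dots> = (\<Sum>W\<in>?X. measure_pmf.prob (gnp n p) {H. all_edges W \<subseteq> snd H})"
    by (subst Bochner_Integration.integral_sum) auto
  also have "\<dots> = (\<Sum>W\<in>?X. p ^ (m choose 2))"
  proof (rule sum.cong[OF refl])
    fix W assume "W \<in> ?X"
    then have W: "W \<subseteq> {1..n}" "card W = m" by auto
    then have "all_edges W \<subseteq> all_edges {1..n}" by (auto simp: all_edges_def)
    moreover have "card (all_edges W) = m choose 2"
      using W card_all_edges[of W] finite_subset[of W "{1..n}"] by simp
    ultimately show "measure_pmf.prob (gnp n p) {H. all_edges W \<subseteq> snd H} = p ^ (m choose 2)"
      using prob_gnp_edges_present[OF assms] by simp
  qed
  also have "\<dots> = real (n choose m) * p ^ (m choose 2)"
    using n_subsets[of "{1..n}" m] by simp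
  finally show ?thesis .
qed

theorem theorem5p1:
  fixes n :: nat and p :: real
  assumes "n \<ge> 1" and "p \<in> {0..1}"
  shows "measure_pmf.expectation (gnp n p) euler_char =
    (\<Sum>k=1..n. (-1) ^ (k + 1) * real (n choose k) * p ^ (k choose 2))"
proof -
  have "measure_pmf.expectation (gnp n p) euler_char =
      measure_pmf.expectation (gnp n p)
        (\<lambda>G. \<Sum>k<n. (-1) ^ k * real (card (cliques G (k + 1))))"
    by (intro integral_cong_AE) (auto simp: AE_measure_pmf_iff euler_char_finite dest!: fst_gnp)
  also have "\<dots> = (\<Sum>k<n. (-1) ^ k *
      measure_pmf.expectation (gnp n p) (\<lambda>G. real (card (cliques G (k + 1)))))"
    by (subst Bochner_Integration.integral_sum) simp_all
  also have "\<dots> = (\<Sum>k<n. (-1) ^ (Suc k + 1) * real (n choose Suc k) * p ^ (Suc k choose 2))"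
    using expectation_card_cliques[OF assms(2)] by (intro sum.cong) simp_all
  also have "\<dots> = (\<Sum>k=1..n. (-1) ^ (k + 1) * real (n choose k) * p ^ (k choose 2))"
    by (rule sum.reindex_bij_witness[of _ "\<lambda>k. k - 1" Suc]) auto
  finally show ?thesis .
qed

end
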